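(* Let $M$ be a matroid on $[n]$ and let $\sigma$ be a face of the matroid base polytope $Q(M)$. Define $P_\sigma$ as follows: (i) the elements of $P_\sigma$ are the connected components of $M_\sigma$; (ii) for distinct connected components $C_1, C_2$ of $M_\sigma$, $C_1 < C_2$ if and only if for every $S \subseteq [n]$ with $C_2 \subseteq S$ and $\sigma \subseteq H_S$ one has $C_1 \subseteq S$. Then $P_\sigma$ is a poset, and $L_\sigma$ is the lattice of order ideals of $P_\sigma$ (a subset of $[n]$ belongs to $L_\sigma$ if and only if it is the union of the components in an order ideal of $P_\sigma$).
   Context: For a matroid $M$ of rank $r$ on $[n]=\{1,\dots,n\}$ with set of bases $\mathcal{B}(M)$, the matroid base polytope is $Q(M)=\mathrm{conv}\{e_B : B\in\mathcal{B}(M)\}\subseteq\mathbb{R}^n$, where $e_B=\sum_{b\in B}e_b$. Every face $\sigma$ of $Q(M)$ is itself the matroid base polytope of a unique matroid on $[n]$, denoted $M_\sigma$. Connected components of a matroid are the classes of the equivalence relation on the ground set generated by $\alpha\sim\beta$ when there are bases $B,B'$ with $B\setminus B'=\{\alpha\}$, $B'\setminus B=\{\beta\}$. For $S\subseteq[n]$, $H_S$ is the hyperplane $\sum_{e\in S}x_e=r(S)$, $r$ the rank function of $M$. For a flag $\mathcal{F}=\{\emptyset=S_0\subseteq S_1\subseteq\cdots\subseteq S_k\subseteq S_{k+1}=[n]\}$, let $M_{\mathcal{F}}=\bigoplus_{i=1}^{k+1}(M|_{S_i})/S_{i-1}$ (restriction then contraction); $Q(M_{\mathcal F})$ is a face of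 $Q(M)$. The flag is factor-connected if each $(M|_{S_i})/S_{i-1}$ is connected. $L_\sigma$ is the set of all subsets of $[n]$ that appear as a member of some factor-connected flag $\mathcal{F}$ with $\sigma=Q(M_{\mathcal F})$, ordered by inclusion. *)

theory Defs
  imports "HOL-Analysis.Analysis"
begin

section \<open>Matroids given by their bases\<close>

text \<open>
  A ground set together with a family of sets; it is a matroid if it satisfies \<open>is_matroid\<close>
  (nonempty family of bases with the exchange axiom). The ground set is explicit because the
  minors below live on subsets of the original ground set.
\<close>

datatype 'a based_set = Based_Set (ground: "'a set") (bases: "'a set set")

definition is_matroid :: "'a based_set \<Rightarrow> bool" where
  "is_matroid M \<longleftrightarrow>
     finite (ground M) \<and> bases M \<noteq> {} \<and> (\<forall>B\<in>bases M. B \<subseteq> ground M) \<and>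
     (\<forall>A\<in>bases M. \<forall>B\<in>bases M. \<forall>a\<in>A - B. \<exists>b\<in>B - A. insert b (A - {a}) \<in> bases M)"

definition indep_in :: "'a based_set \<Rightarrow> 'a set \<Rightarrow> bool" where
  "indep_in M I \<longleftrightarrow> (\<exists>B\<in>bases M. I \<subseteq> B)"

definition matroid_rank :: "'a based_set \<Rightarrow> 'a set \<Rightarrow> nat" where
  "matroid_rank M S = Max (card ` {I. I \<subseteq> S \<and> indep_in M I})"

definition matroid_restrict :: "'a based_set \<Rightarrow> 'a set \<Rightarrow> 'a based_set" where
  "matroid_restrict M S = Based_Set S
     {I. I \<subseteq> S \<and> indep_in M I \<and> (\<forall>J. I \<subseteq> J \<and> J \<subseteq> S \<and> indep_in M J \<longrightarrow> J = I)}"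

definition matroid_contract :: "'a based_set \<Rightarrow> 'a set \<Rightarrow> 'a based_set" where
  "matroid_contract M T = Based_Set (ground M - T)
     {I. I \<subseteq> ground M - T \<and> (\<exists>J\<in>bases (matroid_restrict M T). I \<union> J \<in> bases M)}"

definition direct_sum :: "'i set \<Rightarrow> ('i \<Rightarrow> 'a based_set) \<Rightarrow> 'a based_set" where
  "direct_sum A N = Based_Set (\<Union>i\<in>A. ground (N i))
     {(\<Union>i\<in>A. B i) | B. \<forall>i\<in>A. B i \<in> bases (N i)}"

definition basis_exchange :: "'a based_set \<Rightarrow> 'a \<Rightarrow> 'a \<Rightarrow> bool" where
  "basis_exchange M \<alpha> \<beta> \<longleftrightarrow> (\<exists>B\<in>bases M. \<exists>B'\<in>bases M. B - B' = {\<alpha>} \<and> B' - B = {\<beta>})"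

definition component_rel :: "'a based_set \<Rightarrow> 'a rel" where
  "component_rel M =
     {(\<alpha>, \<beta>). \<alpha> \<in> ground M \<and> \<beta> \<in> ground M \<and> equivclp (basis_exchange M) \<alpha> \<beta>}"

definition matroid_components :: "'a based_set \<Rightarrow> 'a set set" where
  "matroid_components M = ground M // component_rel M"

text \<open>
  The matroid on the empty ground set counts as connected. As flags are allowed to repeat a set,
  this only makes repetitions harmless: it does not change which sets occur in a factor-connected
  flag of a given face.
\<close>

definition matroid_connected :: "'a based_set \<Rightarrow> bool" where
  "matroid_connected M \<longleftrightarrow> (\<forall>\<alpha>\<in>ground M. \<forall>\<beta>\<in>ground M. (\<alpha>, \<beta>) \<in> component_rel M)"


section \<open>Base polytopes, faces and flags\<close>

text \<open>
  The ground set $[n]$ is the index type \<open>'n\<close>, so $n$ is \<open>CARD('n)\<close> and $[n]$ itself is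
  \<open>UNIV :: 'n set\<close>.
\<close>

definition basis_vec :: "'n::finite set \<Rightarrow> real ^ 'n" where
  "basis_vec B = (\<Sum>b\<in>B. axis b 1)"

definition base_polytope :: "'n::finite based_set \<Rightarrow> (real ^ 'n) set" where
  "base_polytope M = convex hull (basis_vec ` bases M)"

definition rank_hyperplane :: "'n::finite based_set \<Rightarrow> 'n set \<Rightarrow> (real ^ 'n) set" where
  "rank_hyperplane M S = {x. (\<Sum>e\<in>S. x $ e) = real (matroid_rank M S)}"

definition face_matroid :: "(real ^ 'n::finite) set \<Rightarrow> 'n based_set" where
  "face_matroid \<sigma> = (THE N. is_matroid N \<and> ground N = UNIV \<and> base_polytope N = \<sigma>)"

text \<open>
  A flag $\emptyset = S_0 \subseteq S_1 \subseteq \dots \subseteq S_k \subseteq S_{k+1} = [n]$ is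
  given by \<open>k\<close> and \<open>S\<close>; the values of \<open>S\<close> beyond \<open>Suc k\<close> are irrelevant.
\<close>

definition is_flag :: "'a based_set \<Rightarrow> nat \<Rightarrow> (nat \<Rightarrow> 'a set) \<Rightarrow> bool" where
  "is_flag M k S \<longleftrightarrow> S 0 = {} \<and> S (Suc k) = ground M \<and> (\<forall>i\<le>k. S i \<subseteq> S (Suc i))"

definition flag_factor :: "'a based_set \<Rightarrow> (nat \<Rightarrow> 'a set) \<Rightarrow> nat \<Rightarrow> 'a based_set" where
  "flag_factor M S i = matroid_contract (matroid_restrict M (S i)) (S (i - 1))"

definition flag_matroid :: "'a based_set \<Rightarrow> nat \<Rightarrow> (nat \<Rightarrow> 'a set) \<Rightarrow> 'a based_set" where
  "flag_matroid M k S = direct_sum {1..Suc k} (flag_factor M S)"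

definition factor_connected :: "'a based_set \<Rightarrow> nat \<Rightarrow> (nat \<Rightarrow> 'a set) \<Rightarrow> bool" where
  "factor_connected M k S \<longleftrightarrow> (\<forall>i\<in>{1..Suc k}. matroid_connected (flag_factor M S i))"

definition L_face :: "'n::finite based_set \<Rightarrow> (real ^ 'n) set \<Rightarrow> 'n set set" where
  "L_face M \<sigma> = {T. \<exists>k S. is_flag M k S \<and> factor_connected M k S \<and>
                     \<sigma> = base_polytope (flag_matroid M k S) \<and> T \<in> S ` {0..Suc k}}"


section \<open>The poset of a face and its order ideals\<close>

definition P_elems :: "(real ^ 'n::finite) set \<Rightarrow> 'n set set" where
  "P_elems \<sigma> = matroid_components (face_matroid \<sigma>)"

definition P_less ::
    "'n::finite based_set \<Rightarrow> (real ^ 'n) set \<Rightarrow> 'n set \<Rightarrow> 'n set \<Rightarrow> bool" where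
  "P_less M \<sigma> C\<^sub>1 C\<^sub>2 \<longleftrightarrow>
     C\<^sub>1 \<noteq> C\<^sub>2 \<and> (\<forall>S. C\<^sub>2 \<subseteq> S \<and> \<sigma> \<subseteq> rank_hyperplane M S \<longrightarrow> C\<^sub>1 \<subseteq> S)"

definition P_le :: "'n::finite based_set \<Rightarrow> (real ^ 'n) set \<Rightarrow> 'n set rel" where
  "P_le M \<sigma> =
     {(C\<^sub>1, C\<^sub>2). C\<^sub>1 \<in> P_elems \<sigma> \<and> C\<^sub>2 \<in> P_elems \<sigma> \<and> (C\<^sub>1 = C\<^sub>2 \<or> P_less M \<sigma> C\<^sub>1 C\<^sub>2)}"

definition order_ideals :: "'a set \<Rightarrow> 'a rel \<Rightarrow> 'a set set" where
  "order_ideals A r = {I. I \<subseteq> A \<and> (\<forall>x\<in>I. \<forall>y\<in>A. (y, x) \<in> r \<longrightarrow> y \<in> I)}"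

end

theory Submission
  imports Defs
begin

text \<open>
  A face of the base polytope is spanned by the bases of maximal weight for some weight function,
  and these are the bases of its matroid. The subsets \<open>S\<close> with the face contained in
  \<open>H\<^sub>S\<close>, called tight below, contain \<open>\<emptyset>\<close> and the ground set, are closed under union
  and intersection, and are unions of components. If one tight set covers another, their
  difference is a single component; so every maximal chain of tight sets is a factor-connected
  flag of the face, and \<open>L_face\<close> consists of the tight sets. The same fact separates any two
  components by a tight set, which gives antisymmetry, and the identification with order ideals is
  then Birkhoff's correspondence for a ring of sets.
\<close>

section \<open>Matroids\<close>

lemma card_swap:
  assumes "finite A" "a \<in> A" "b \<notin> A"
  shows "card (insert b (A - {a})) = card A"
  using assms by (metis card_Suc_Diff1 card_insert_disjoint finite_Diff Diff_iff)

locale matroid =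
  fixes M :: "'a based_set"
  assumes is_matroid: "is_matroid M"
begin

lemma finite_ground: "finite (ground M)"
  using is_matroid by (simp add: is_matroid_def)

lemma base_subset_ground: "B \<in> bases M \<Longrightarrow> B \<subseteq> ground M"
  using is_matroid by (simp add: is_matroid_def)

lemma finite_base: "B \<in> bases M \<Longrightarrow> finite B"
  using base_subset_ground finite_ground finite_subset by blast

lemma base_exchange:
  assumes "A \<in> bases M" "B \<in> bases M" "a \<in> A - B"
  obtains b where "b \<in> B - A" "insert b (A - {a}) \<in> bases M"
  using is_matroid assms unfolding is_matroid_def by blast

text \<open>Each exchange of an element of \<open>A - B\<close> for one of \<open>B - A\<close>
  preserves the size of \<open>A\<close> and shrinks \<open>A - B\<close>, until \<open>A\<close>
  lies inside \<open>B\<close>.\<close>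

lemma card_base_le:
  assumes "A \<in> bases M" "B \<in> bases M"
  shows "card A \<le> card B"
  using assms(1)
proof (induction "card (A - B)" arbitrary: A rule: less_induct)
  case less
  show ?case
  proof (cases "A \<subseteq> B")
    case True
    then show ?thesis using finite_base[OF assms(2)] by (rule card_mono[rotated])
  next
    case False
    then obtain a where a: "a \<in> A - B" by blast
    obtain b where b: "b \<in> B - A" "insert b (A - {a}) \<in> bases M"
      using base_exchange[OF less.prems assms(2) a] by blast
    have "insert b (A - {a}) - B = (A - B) - {a}" using b by blast
    then have "card (insert b (A - {a}) - B) < card (A - B)"
      using a finite_base[OF less.prems] by (metis card_Diff1_less finite_Diff)
    from less.hyps[OF this b(2)] show ?thesis
      using a b card_swap[OF finite_base[OF less.prems]] by simp
  qed
qed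

lemma card_base_eq: "A \<in> bases M \<Longrightarrow> B \<in> bases M \<Longrightarrow> card A = card B"
  by (simp add: card_base_le le_antisym)

section \<open>Independent sets: extension and augmentation\<close>

lemma indep_mono: "indep_in M I \<Longrightarrow> J \<subseteq> I \<Longrightarrow> indep_in M J"
  unfolding indep_in_def by blast

lemma base_indep: "B \<in> bases M \<Longrightarrow> indep_in M B"
  unfolding indep_in_def by blast

lemma indep_empty: "indep_in M {}"
  using is_matroid unfolding indep_in_def is_matroid_def by auto

lemma finite_indep: "indep_in M I \<Longrightarrow> finite I"
  unfolding indep_in_def using finite_base finite_subset by blast

text \<open>Among the bases containing \<open>I\<close>, take one with fewest elements outside
  \<open>I \<union> B\<close>. Such an element could be exchanged for one of \<open>B\<close>
  without touching \<open>I\<close>, so there is none.\<close>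

lemma indep_extend_to_base:
  assumes "indep_in M I" "B \<in> bases M"
  obtains A where "A \<in> bases M" "I \<subseteq> A" "A \<subseteq> I \<union> B"
proof -
  obtain A0 where "A0 \<in> bases M \<and> I \<subseteq> A0"
    using assms(1) unfolding indep_in_def by blast
  from ex_has_least_nat[of "\<lambda>A. A \<in> bases M \<and> I \<subseteq> A", OF this, of "\<lambda>A. card (A - (I \<union> B))"]
  obtain A where A: "A \<in> bases M \<and> I \<subseteq> A"
    and min: "\<And>A'. A' \<in> bases M \<and> I \<subseteq> A' \<Longrightarrow> card (A - (I \<union> B)) \<le> card (A' - (I \<union> B))"
    by blast
  have "A \<subseteq> I \<union> B"
  proof (rule ccontr)
    assume "\<not> A \<subseteq> I \<union> B"
    then obtain x where x: "x \<in> A" "x \<notin> I" "x \<notin> B" by blast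
    obtain y where y: "y \<in> B - A" "insert y (A - {x}) \<in> bases M"
      using base_exchange[of A B x] A assms(2) x by blast
    have "insert y (A - {x}) - (I \<union> B) = A - (I \<union> B) - {x}" using y by blast
    then have "card (insert y (A - {x}) - (I \<union> B)) < card (A - (I \<union> B))"
      using x finite_base A by (metis DiffI UnE card_Diff1_less finite_Diff)
    then show False using min[of "insert y (A - {x})"] A x y by auto
  qed
  with A show ?thesis using that by blast
qed

text \<open>Complete \<open>I\<close> to a basis \<open>B\<close>, and \<open>J\<close> to a basis
  \<open>A\<close> inside \<open>J \<union> B\<close>. If no element of \<open>J - I\<close> could
  be added to \<open>I\<close>, all of \<open>J - I\<close> would lie in \<open>A - B\<close>, while
  exchange would force \<open>B - A\<close> into \<open>I - J\<close>. As \<open>A - B\<close> and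
  \<open>B - A\<close> have equal size, \<open>J\<close> could not be larger than
  \<open>I\<close>.\<close>

lemma indep_augment:
  assumes I: "indep_in M I" and J: "indep_in M J" and less: "card I < card J"
  shows "\<exists>e\<in>J - I. indep_in M (insert e I)"
proof (rule ccontr)
  assume none: "\<not> ?thesis"
  obtain B where B: "B \<in> bases M" "I \<subseteq> B" using I unfolding indep_in_def by blast
  \<comment> \<open>An element of \<open>J - I\<close> lying in \<open>B\<close> could be added to
    \<open>I\<close> within \<open>B\<close>.\<close>
  have JB: "J - B = J - I"
    using none B unfolding indep_in_def by blast
  obtain A where A: "A \<in> bases M" "J \<subseteq> A" "A \<subseteq> J \<union> B"
    using indep_extend_to_base[OF J B(1)] by blast
  have "B - A \<subseteq> I - J"
  proof
    fix x assume x: "x \<in> B - A"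
    have "x \<in> I"
    proof (rule ccontr)
      assume "x \<notin> I"
      obtain y where y: "y \<in> A - B" "insert y (B - {x}) \<in> bases M"
        using base_exchange[OF B(1) A(1) x] by blast
      have "y \<in> J - I" using y A JB by blast
      moreover have "insert y I \<subseteq> insert y (B - {x})" using B \<open>x \<notin> I\<close> by blast
      ultimately show False using none y(2) unfolding indep_in_def by blast
    qed
    then show "x \<in> I - J" using x A by blast
  qed
  then have "card (B - A) \<le> card (I - J)" using finite_indep[OF I] by (simp add: card_mono)
  moreover have "card (B - A) = card (A - B)"
    using card_base_eq[OF A(1) B(1)] finite_base[OF A(1)] finite_base[OF B(1)]
    by (metis card_Diff_subset_Int finite_Int inf_commute)
  moreover have "card (J - I) \<le> card (A - B)"
    using JB A finite_base[OF A(1)] by (metis Diff_mono card_mono finite_Diff order_refl)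
  moreover have "card I = card (I - J) + card (I \<inter> J)" "card J = card (J - I) + card (I \<inter> J)"
    using finite_indep[OF I] finite_indep[OF J]
    by (metis card_Diff_subset_Int card_mono finite_Int inf_le1 le_add_diff_inverse2,
        metis card_Diff_subset_Int card_mono finite_Int inf_le2 inf_commute le_add_diff_inverse2)
  ultimately show False using less by linarith
qed

lemma indep_extend:
  assumes "indep_in M I" "indep_in M K" "card I \<le> card K"
  obtains L where "indep_in M L" "I \<subseteq> L" "L \<subseteq> I \<union> K" "card L = card K"
  using assms(1,3)
proof (induction "card K - card I" arbitrary: I thesis)
  case 0
  then show ?case using assms(2) by (metis diff_is_0_eq le_antisym order_refl sup_ge1)
next
  case (Suc n)
  then have "card I < card K" by linarith
  then obtain e where e: "e \<in> K - I" "indep_in M (insert e I)"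
    using indep_augment[OF Suc.prems(2) assms(2)] by blast
  have c: "card (insert e I) = Suc (card I)"
    using e finite_indep[OF Suc.prems(2)] by simp
  have "n = card K - card (insert e I)" "card (insert e I) \<le> card K"
    using Suc.hyps(2) c \<open>card I < card K\<close> by linarith+
  from Suc.hyps(1)[OF this(1) _ e(2) this(2)]
  obtain L where "indep_in M L" "insert e I \<subseteq> L" "L \<subseteq> insert e I \<union> K" "card L = card K"
    by blast
  then show ?case using Suc.prems(1)[of L] e by blast
qed

section \<open>The rank function\<close>

lemma finite_indep_sets: "finite {I. I \<subseteq> S \<and> indep_in M I}"
proof -
  have "{I. I \<subseteq> S \<and> indep_in M I} \<subseteq> Pow (ground M)"
    unfolding indep_in_def using base_subset_ground by blast
  then show ?thesis using finite_ground finite_subset by blast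
qed

lemma card_indep_le_rank: "I \<subseteq> S \<Longrightarrow> indep_in M I \<Longrightarrow> card I \<le> matroid_rank M S"
  unfolding matroid_rank_def using finite_indep_sets[of S] by (intro Max_ge) auto

lemma rank_attained:
  obtains I where "I \<subseteq> S" "indep_in M I" "card I = matroid_rank M S"
proof -
  have "matroid_rank M S \<in> card ` {I. I \<subseteq> S \<and> indep_in M I}"
    unfolding matroid_rank_def using finite_indep_sets[of S] indep_empty by (intro Max_in) auto
  then show ?thesis using that by auto
qed

lemma rank_empty: "matroid_rank M {} = 0"
  using rank_attained[of "{}"] by (metis card.empty subset_empty)

lemma indep_extend_to_rank:
  assumes "I \<subseteq> S" "indep_in M I"
  obtains L where "I \<subseteq> L" "L \<subseteq> S" "indep_in M L" "card L = matroid_rank M S"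
proof -
  obtain K where K: "K \<subseteq> S" "indep_in M K" "card K = matroid_rank M S" by (rule rank_attained)
  have "card I \<le> card K" using card_indep_le_rank[OF assms] K by simp
  from indep_extend[OF assms(2) K(2) this] show ?thesis
    using that assms K by (metis le_sup_iff order_trans)
qed

lemma base_iff_rank_ground:
  "B \<in> bases M \<longleftrightarrow> indep_in M B \<and> card B = matroid_rank M (ground M)"
proof -
  have rank: "card B = matroid_rank M (ground M)" if B: "B \<in> bases M" for B
  proof -
    obtain I where I: "I \<subseteq> ground M" "indep_in M I" "card I = matroid_rank M (ground M)"
      by (rule rank_attained)
    then obtain A where A: "A \<in> bases M" "I \<subseteq> A" unfolding indep_in_def by blast
    have "card I \<le> card B" using card_mono[OF finite_base[OF A(1)] A(2)] card_base_eq[OF A(1) B] by simp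
    then show ?thesis
      using I card_indep_le_rank[OF base_subset_ground[OF B] base_indep[OF B]] by simp
  qed
  have "B \<in> bases M" if B: "indep_in M B" "card B = matroid_rank M (ground M)"
  proof -
    obtain A where A: "A \<in> bases M" "B \<subseteq> A" using B(1) unfolding indep_in_def by blast
    then have "B = A" using B(2) rank[OF A(1)] finite_base[OF A(1)] by (simp add: card_subset_eq)
    then show ?thesis using A by simp
  qed
  then show ?thesis using rank base_indep by blast
qed

text \<open>Local optimality implies global optimality: if \<open>B \<inter> S\<close> is smaller
  than the rank, some \<open>e\<close> of \<open>S\<close> can be added to it, and completing the
  result by elements of \<open>B\<close> drops exactly one \<open>f\<close>, which lies outside
  \<open>S\<close>. Rank conditions thus become conditions on single exchanges.\<close>

lemma card_Int_base_eq_rank_iff: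
  assumes B: "B \<in> bases M"
  shows "card (B \<inter> S) = matroid_rank M S \<longleftrightarrow>
    (\<forall>e\<in>S - B. \<forall>f\<in>B - S. insert e (B - {f}) \<notin> bases M)"
proof
  assume eq: "card (B \<inter> S) = matroid_rank M S"
  show "\<forall>e\<in>S - B. \<forall>f\<in>B - S. insert e (B - {f}) \<notin> bases M"
  proof (intro ballI notI)
    fix e f assume e: "e \<in> S - B" and f: "f \<in> B - S" and "insert e (B - {f}) \<in> bases M"
    then have "indep_in M (insert e (B \<inter> S))"
      by (intro indep_mono[OF base_indep]) auto
    then have "card (insert e (B \<inter> S)) \<le> matroid_rank M S"
      using e by (intro card_indep_le_rank) auto
    then show False using eq e finite_base[OF B] by simp
  qed
next
  assume none: "\<forall>e\<in>S - B. \<forall>f\<in>B - S. insert e (B - {f}) \<notin> bases M"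
  have ind: "indep_in M (B \<inter> S)" using B by (intro indep_mono[OF base_indep]) auto
  show "card (B \<inter> S) = matroid_rank M S"
  proof (rule ccontr)
    assume "card (B \<inter> S) \<noteq> matroid_rank M S"
    then have less: "card (B \<inter> S) < matroid_rank M S"
      using card_indep_le_rank[OF _ ind, of S] by simp
    obtain J where J: "J \<subseteq> S" "indep_in M J" "card J = matroid_rank M S" by (rule rank_attained)
    obtain e where e: "e \<in> J - (B \<inter> S)" "indep_in M (insert e (B \<inter> S))"
      using indep_augment[OF ind J(2)] less J(3) by auto
    obtain A where A: "A \<in> bases M" "insert e (B \<inter> S) \<subseteq> A" "A \<subseteq> insert e (B \<inter> S) \<union> B"
      using indep_extend_to_base[OF e(2) B] by blast
    have eS: "e \<in> S - B" using e J by blast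
    have "\<not> B \<subseteq> A"
      using A eS card_base_eq[OF A(1) B] card_subset_eq[OF finite_base[OF A(1)], of B] by auto
    then obtain f where f: "f \<in> B" "f \<notin> A" by blast
    have "A \<subseteq> insert e (B - {f})" using A f by blast
    moreover have "card A = card (insert e (B - {f}))"
      using card_base_eq[OF A(1) B] f eS card_swap[OF finite_base[OF B]] by simp
    ultimately have "A = insert e (B - {f})"
      using finite_base[OF B] by (intro card_subset_eq) auto
    then show False using none A(1) eS f A(2) by blast
  qed
qed

section \<open>Restriction, contraction and flags\<close>

lemma bases_restrict:
  "bases (matroid_restrict M S) = {I. I \<subseteq> S \<and> indep_in M I \<and> card I = matroid_rank M S}"
proof -
  have "card I = matroid_rank M S \<longleftrightarrow> (\<forall>J. I \<subseteq> J \<and> J \<subseteq> S \<and> indep_in M J \<longrightarrow> J = I)"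
    if I: "I \<subseteq> S" "indep_in M I" for I
  proof
    assume c: "card I = matroid_rank M S"
    show "\<forall>J. I \<subseteq> J \<and> J \<subseteq> S \<and> indep_in M J \<longrightarrow> J = I"
    proof (intro allI impI; elim conjE)
      fix J assume "I \<subseteq> J" "J \<subseteq> S" "indep_in M J"
      then show "J = I"
        using c card_indep_le_rank[of J S] finite_indep[of J] card_seteq[of J I] by simp
    qed
  next
    assume "\<forall>J. I \<subseteq> J \<and> J \<subseteq> S \<and> indep_in M J \<longrightarrow> J = I"
    then show "card I = matroid_rank M S" using indep_extend_to_rank[OF I] by metis
  qed
  then show ?thesis unfolding matroid_restrict_def based_set.sel
    by (intro Collect_cong iffI conjI; elim conjE; simp only:)
qed

lemma indep_in_restrict: "indep_in (matroid_restrict M S) I \<longleftrightarrow> I \<subseteq> S \<and> indep_in M I"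
proof
  assume "indep_in (matroid_restrict M S) I"
  then show "I \<subseteq> S \<and> indep_in M I"
    unfolding indep_in_def[of "matroid_restrict M S"] bases_restrict using indep_mono by blast
next
  assume "I \<subseteq> S \<and> indep_in M I"
  then obtain L where "I \<subseteq> L" "L \<subseteq> S" "indep_in M L" "card L = matroid_rank M S"
    using indep_extend_to_rank by blast
  then show "indep_in (matroid_restrict M S) I"
    unfolding indep_in_def[of "matroid_restrict M S"] bases_restrict by blast
qed

lemma restrict_restrict:
  assumes "T \<subseteq> S"
  shows "matroid_restrict (matroid_restrict M S) T = matroid_restrict M T"
proof -
  have "J \<subseteq> S" if "J \<subseteq> T" for J using that assms by blast
  then show ?thesis
    unfolding matroid_restrict_def[of "matroid_restrict M S"] matroid_restrict_def[of M T]
      indep_in_restrict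
    by (simp cong: conj_cong)
qed

section \<open>Factors of a flag and the bases of their direct sum\<close>

lemma ground_flag_factor: "ground (flag_factor M S i) = S i - S (i - 1)"
  by (simp add: flag_factor_def matroid_contract_def matroid_restrict_def)

lemma bases_flag_factor:
  assumes "S (i - 1) \<subseteq> S i"
  shows "bases (flag_factor M S i) =
    {X. X \<subseteq> S i - S (i - 1) \<and>
      (\<exists>J \<subseteq> S (i - 1). indep_in M J \<and> card J = matroid_rank M (S (i - 1)) \<and>
         indep_in M (X \<union> J) \<and> card (X \<union> J) = matroid_rank M (S i))}"
proof -
  have g: "ground (matroid_restrict M (S i)) = S i" by (simp add: matroid_restrict_def)
  show ?thesis
    unfolding flag_factor_def matroid_contract_def based_set.sel restrict_restrict[OF assms] g
      bases_restrict
    using assms by auto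
qed

text \<open>Contraction asks only for some basis \<open>J\<close> of the contracted set
  \<open>T\<close>; here any other basis \<open>K\<close> is shown to serve as well. Extend
  \<open>K\<close> by elements of \<open>X \<union> J\<close>: since \<open>K\<close> has full rank
  in \<open>T\<close>, nothing more of \<open>T\<close> enters, and counting forces all of
  \<open>X\<close> to be used.\<close>

lemma indep_Un_exchange:
  assumes T: "T \<subseteq> S" and X: "X \<subseteq> S - T"
    and J: "J \<subseteq> T" "indep_in M J" "card J = matroid_rank M T"
    and XJ: "indep_in M (X \<union> J)" "card (X \<union> J) = matroid_rank M S"
    and K: "K \<subseteq> T" "indep_in M K" "card K = matroid_rank M T"
  shows "indep_in M (X \<union> K)" "card (X \<union> K) = matroid_rank M S"
proof -
  have "card K \<le> card (X \<union> J)"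
    using K T XJ card_indep_le_rank[of K S] by auto
  then obtain L where L: "indep_in M L" "K \<subseteq> L" "L \<subseteq> K \<union> (X \<union> J)" "card L = card (X \<union> J)"
    using indep_extend[OF K(2) XJ(1)] by blast
  have LT: "L \<inter> T = K"
  proof -
    have "card (L \<inter> T) \<le> card K"
      using K(3) L(1) card_indep_le_rank[of "L \<inter> T" T] indep_mono[of L "L \<inter> T"] by auto
    then show ?thesis using L K finite_indep[OF L(1)] card_seteq[of "L \<inter> T" K] by auto
  qed
  have sub: "L \<subseteq> X \<union> K" using L LT J by blast
  have fin: "finite X" "finite J" "finite K"
    using finite_indep[OF XJ(1)] finite_indep[OF K(2)] by auto
  have "X \<inter> J = {}" "X \<inter> K = {}" using X J K by blast+
  then have "card (X \<union> J) = card X + card J" "card (X \<union> K) = card X + card K"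
    using fin by (simp_all add: card_Un_disjoint)
  then have card: "card (X \<union> K) = card (X \<union> J)" using J K by simp
  then have "L = X \<union> K" using sub L fin by (intro card_subset_eq) auto
  then show "indep_in M (X \<union> K)" "card (X \<union> K) = matroid_rank M S"
    using L card XJ by auto
qed

lemma flag_mono:
  assumes "is_flag M k S" "i \<le> j" "j \<le> Suc k"
  shows "S i \<subseteq> S j"
  using assms(2,3)
proof (induction j rule: dec_induct)
  case (step n)
  then show ?case using assms(1) unfolding is_flag_def by force
qed simp

lemma flag_step_exists:
  assumes flag: "is_flag M k S" and "n \<le> Suc k" "x \<in> S n"
  obtains i where "i \<in> {1..n}" "x \<in> S i - S (i - 1)"
proof -
  define i where "i = (LEAST i. x \<in> S i)"
  have i: "x \<in> S i" "i \<le> n" unfolding i_def using assms(3) by (auto intro: LeastI Least_le)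
  have "i \<noteq> 0" using flag i unfolding is_flag_def by (metis empty_iff)
  then have "x \<notin> S (i - 1)" unfolding i_def by (metis diff_less not_less_Least zero_less_one not_gr_zero)
  then show ?thesis using that[of i] i \<open>i \<noteq> 0\<close> by simp
qed

lemma Int_flag_step_base_flag_factor:
  assumes flag: "is_flag M k S" and B: "B \<in> bases M"
    and card: "\<And>i. i \<le> Suc k \<Longrightarrow> card (B \<inter> S i) = matroid_rank M (S i)"
    and i: "i \<in> {1..Suc k}"
  shows "B \<inter> (S i - S (i - 1)) \<in> bases (flag_factor M S i)"
proof -
  have step: "S (i - 1) \<subseteq> S i" using flag_mono[OF flag, of "i - 1" i] i by auto
  have "indep_in M (B \<inter> S j)" for j using B by (intro indep_mono[OF base_indep]) auto
  moreover have "B \<inter> (S i - S (i - 1)) \<union> (B \<inter> S (i - 1)) = B \<inter> S i" using step by blast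
  ultimately show ?thesis
    unfolding bases_flag_factor[of S i, OF step]
    using card i by (auto intro!: exI[of _ "B \<inter> S (i - 1)"])
qed

text \<open>Bases of the factors are glued by induction along the flag, the auxiliary basis of
  \<open>S i\<close> in each contraction being replaced by \<open>B \<inter> S i\<close>.
  Conversely, a basis of full rank on every member of the flag is cut by the successive differences
  into bases of the factors.\<close>

lemma bases_flag_matroid:
  assumes flag: "is_flag M k S"
  shows "bases (flag_matroid M k S) =
    {B \<in> bases M. \<forall>i\<le>Suc k. card (B \<inter> S i) = matroid_rank M (S i)}"
proof -
  have step: "S (i - 1) \<subseteq> S i" if "i \<in> {1..Suc k}" for i
    using flag_mono[OF flag, of "i - 1" i] that by auto
  have S0: "S 0 = {}" and SK: "S (Suc k) = ground M" using flag by (auto simp: is_flag_def)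
  show ?thesis
  proof (intro subset_antisym subsetI)
    fix B assume "B \<in> bases (flag_matroid M k S)"
    then obtain X where B: "B = (\<Union>i\<in>{1..Suc k}. X i)"
      and X: "\<And>i. i \<in> {1..Suc k} \<Longrightarrow> X i \<in> bases (flag_factor M S i)"
      unfolding flag_matroid_def direct_sum_def by auto
    have Xsub: "X i \<subseteq> S i - S (i - 1)" if "i \<in> {1..Suc k}" for i
      using X[OF that] bases_flag_factor[OF step[OF that]] by blast
    have Xd: "X j \<inter> S i = {}" if "j \<in> {1..Suc k}" "i < j" for i j
    proof -
      have "S i \<subseteq> S (j - 1)" using that by (intro flag_mono[OF flag]) auto
      then show ?thesis using Xsub[OF that(1)] by blast
    qed
    have main: "indep_in M (B \<inter> S i) \<and> card (B \<inter> S i) = matroid_rank M (S i)" if "i \<le> Suc k" for i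
      using that
    proof (induction i)
      case 0
      then show ?case using S0 indep_empty rank_empty by simp
    next
      case (Suc i)
      then have i: "Suc i \<in> {1..Suc k}" by simp
      have eq: "B \<inter> S (Suc i) = X (Suc i) \<union> (B \<inter> S i)"
      proof (intro subset_antisym subsetI)
        fix x assume x: "x \<in> B \<inter> S (Suc i)"
        then obtain j where j: "j \<in> {1..Suc k}" "x \<in> X j" using B by blast
        have "\<not> Suc i < j" using Xd[of j "Suc i"] j x by blast
        then consider "j = Suc i" | "j \<le> i" by linarith
        then show "x \<in> X (Suc i) \<union> (B \<inter> S i)"
        proof cases
          case 2
          then have "x \<in> S i" using Xsub[OF j(1)] j(2) flag_mono[OF flag, of j i] Suc.prems by auto
          then show ?thesis using x by blast
        qed (use j in auto)
      next
        fix x assume "x \<in> X (Suc i) \<union> (B \<inter> S i)"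
        then show "x \<in> B \<inter> S (Suc i)" using Xsub[OF i] i B step[OF i] by auto
      qed
      have IH: "indep_in M (B \<inter> S i)" "card (B \<inter> S i) = matroid_rank M (S i)"
        using Suc by auto
      have st: "S i \<subseteq> S (Suc i)" "X (Suc i) \<subseteq> S (Suc i) - S i"
        using step[OF i] Xsub[OF i] by auto
      obtain J where J: "J \<subseteq> S i" "indep_in M J" "card J = matroid_rank M (S i)"
         "indep_in M (X (Suc i) \<union> J)" "card (X (Suc i) \<union> J) = matroid_rank M (S (Suc i))"
        using X[OF i] unfolding bases_flag_factor[OF step[OF i]] by auto
      show ?case
        unfolding eq
        using indep_Un_exchange[OF st J _ IH] by simp
    qed
    have "B \<subseteq> ground M"
      using B Xsub SK flag_mono[OF flag _ order_refl] by fastforce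
    then have "B \<inter> S (Suc k) = B" using SK by blast
    then have "B \<in> bases M" using main[of "Suc k"] SK base_iff_rank_ground by simp
    then show "B \<in> {B \<in> bases M. \<forall>i\<le>Suc k. card (B \<inter> S i) = matroid_rank M (S i)}"
      using main by simp
  next
    fix B assume "B \<in> {B \<in> bases M. \<forall>i\<le>Suc k. card (B \<inter> S i) = matroid_rank M (S i)}"
    then have B: "B \<in> bases M" and card: "\<And>i. i \<le> Suc k \<Longrightarrow> card (B \<inter> S i) = matroid_rank M (S i)"
      by auto
    have "B \<inter> (S i - S (i - 1)) \<in> bases (flag_factor M S i)" if "i \<in> {1..Suc k}" for i
      using Int_flag_step_base_flag_factor[OF flag B card] that by blast
    moreover have "B = (\<Union>i\<in>{1..Suc k}. B \<inter> (S i - S (i - 1)))"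
    proof (intro subset_antisym subsetI)
      fix x assume x: "x \<in> B"
      then have "x \<in> S (Suc k)" using SK base_subset_ground[OF B] by blast
      then show "x \<in> (\<Union>i\<in>{1..Suc k}. B \<inter> (S i - S (i - 1)))"
        using flag_step_exists[OF flag order_refl] x by blast
    qed blast
    ultimately show "B \<in> bases (flag_matroid M k S)"
      unfolding flag_matroid_def direct_sum_def based_set.sel mem_Collect_eq by blast
  qed
qed

end

section \<open>Bases of maximal weight\<close>

locale max_weight_bases = matroid M for M :: "'a::finite based_set" +
  fixes w :: "'a \<Rightarrow> real" and c :: real
  assumes ground_UNIV: "ground M = UNIV"
    and weight_le: "\<And>B. B \<in> bases M \<Longrightarrow> sum w B \<le> c"
    and weight_attained: "\<exists>B\<in>bases M. sum w B = c"
begin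

text \<open>The candidate for the matroid of a face: \<open>w\<close> and \<open>c\<close> will come
  from a linear inequality that is valid on the polytope and whose equality case is the
  face.\<close>

definition opt :: "'a based_set" where
  "opt = Based_Set UNIV {B \<in> bases M. sum w B = c}"

text \<open>The combinatorial form of the containment of the face in the hyperplane of
  \<open>S\<close>, tested on the vertices of the face.\<close>

definition tight :: "'a set set" where
  "tight = {S. \<forall>B\<in>bases opt. card (B \<inter> S) = matroid_rank M S}"

lemma bases_opt: "B \<in> bases opt \<longleftrightarrow> B \<in> bases M \<and> sum w B = c"
  by (simp add: opt_def)

section \<open>Exchanges in optimal bases and tight sets\<close>

lemma swap_weight:
  assumes "B \<in> bases opt" "e \<notin> B" "f \<in> B" "insert e (B - {f}) \<in> bases M"
  shows "w e \<le> w f" and "w f \<le> w e \<Longrightarrow> insert e (B - {f}) \<in> bases opt"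
proof -
  have "sum w (insert e (B - {f})) = w e + (sum w B - w f)"
    using assms by (simp add: sum_diff1)
  then show "w e \<le> w f" "w f \<le> w e \<Longrightarrow> insert e (B - {f}) \<in> bases opt"
    using assms weight_le[OF assms(4)] by (auto simp: bases_opt)
qed

text \<open>Draw an arrow from \<open>e\<close> to \<open>f\<close> if some optimal basis containing
  \<open>f\<close> but not \<open>e\<close> remains a basis of \<open>M\<close> when
  \<open>f\<close> is replaced by \<open>e\<close>. The local criterion for full rank says that
  tight sets are the sets closed under these arrows; closure under arbitrary unions and
  intersections is then immediate.\<close>

lemma mem_tight_iff:
  "S \<in> tight \<longleftrightarrow> (\<forall>B\<in>bases opt. \<forall>e\<in>S - B. \<forall>f\<in>B - S. insert e (B - {f}) \<notin> bases M)"
  unfolding tight_def using card_Int_base_eq_rank_iff bases_opt by simp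

lemma tightD:
  assumes "S \<in> tight" "B \<in> bases opt" "insert e (B - {f}) \<in> bases M"
    and "e \<notin> B" "f \<in> B" "e \<in> S"
  shows "f \<in> S"
  using assms unfolding mem_tight_iff by blast

lemma Union_tight: "\<S> \<subseteq> tight \<Longrightarrow> \<Union>\<S> \<in> tight"
  unfolding mem_tight_iff[of "\<Union>\<S>"] using tightD by blast

lemma Inter_tight: "\<S> \<subseteq> tight \<Longrightarrow> \<Inter>\<S> \<in> tight"
  unfolding mem_tight_iff[of "\<Inter>\<S>"] using tightD by blast

lemma Un_tight: "S \<in> tight \<Longrightarrow> T \<in> tight \<Longrightarrow> S \<union> T \<in> tight"
  using Union_tight[of "{S, T}"] by simp

lemma Int_tight: "S \<in> tight \<Longrightarrow> T \<in> tight \<Longrightarrow> S \<inter> T \<in> tight"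
  using Inter_tight[of "{S, T}"] by simp

lemma empty_tight: "{} \<in> tight"
  using Union_tight[of "{}"] by simp

lemma UNIV_tight: "UNIV \<in> tight"
  using Inter_tight[of "{}"] by simp

text \<open>An exchange that brings \<open>e\<close> in for \<open>f\<close> cannot exceed the
  maximal weight, so \<open>w e \<le> w f\<close> and superlevel sets are closed under the
  arrows.\<close>

lemma superlevel_tight: "{x. t \<le> w x} \<in> tight"
  unfolding mem_tight_iff using swap_weight(1) by force

text \<open>Both bases have full rank on the tight set \<open>U\<close> of elements at least as
  heavy as \<open>a\<close>. So \<open>A \<inter> U\<close> without \<open>a\<close> can be
  augmented by some \<open>b\<close> of \<open>B \<inter> U\<close>, and completing it inside
  \<open>A\<close> replaces \<open>a\<close> by \<open>b\<close>. As \<open>b\<close> is no lighter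
  than \<open>a\<close>, the new basis is again optimal.\<close>

lemma opt_matroid: "is_matroid opt"
  unfolding is_matroid_def
proof (intro conjI ballI)
  show "bases opt \<noteq> {}" using weight_attained bases_opt by blast
  fix A B a assume A: "A \<in> bases opt" and B: "B \<in> bases opt" and a: "a \<in> A - B"
  define U where "U = {x. w a \<le> w x}"
  have AM: "A \<in> bases M" and BM: "B \<in> bases M" using A B bases_opt by auto
  have U: "card (A \<inter> U) = matroid_rank M U" "card (B \<inter> U) = matroid_rank M U"
    using superlevel_tight[of "w a"] A B unfolding U_def tight_def by auto
  have aU: "a \<in> A \<inter> U" using a by (simp add: U_def)
  have ind: "indep_in M (A \<inter> U - {a})" "indep_in M (B \<inter> U)"
    using indep_mono[OF base_indep[OF AM], of "A \<inter> U - {a}"]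
      indep_mono[OF base_indep[OF BM], of "B \<inter> U"] by auto
  have "card (A \<inter> U - {a}) < card (A \<inter> U)" using aU by (intro card_Diff1_less) auto
  then have "card (A \<inter> U - {a}) < card (B \<inter> U)" using U by simp
  then obtain b where b: "b \<in> B \<inter> U - (A \<inter> U - {a})" "indep_in M (insert b (A \<inter> U - {a}))"
    using indep_augment[OF ind] by blast
  then have bBA: "b \<in> B - A" using a by blast
  obtain L where L: "L \<in> bases M" "insert b (A \<inter> U - {a}) \<subseteq> L"
      "L \<subseteq> insert b (A \<inter> U - {a}) \<union> A"
    using indep_extend_to_base[OF b(2) AM] by blast
  \<comment> \<open>Otherwise \<open>A \<inter> U\<close> together with \<open>b\<close> would be an
    independent subset of \<open>U\<close> larger than its rank.\<close>
  have "a \<notin> L"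
  proof
    assume "a \<in> L"
    then have "indep_in M (insert b (A \<inter> U))" "insert b (A \<inter> U) \<subseteq> U"
      using L b by (auto intro!: indep_mono[OF base_indep[OF L(1)]])
    then have "card (insert b (A \<inter> U)) \<le> card (A \<inter> U)" using U card_indep_le_rank by simp
    then show False using bBA by simp
  qed
  then have "L \<subseteq> insert b (A - {a})" using L by blast
  moreover have "card (insert b (A - {a})) = card L"
    using card_swap[of A a b] card_base_eq[OF L(1) AM] aU bBA by simp
  ultimately have "L = insert b (A - {a})" by (intro card_subset_eq) auto
  then have "insert b (A - {a}) \<in> bases opt"
    using swap_weight(2)[OF A, of b a] L b aU bBA by (auto simp: U_def)
  then show "\<exists>b\<in>B - A. insert b (A - {a}) \<in> bases opt" using bBA by blast
qed (auto simp: opt_def)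

section \<open>Components of the optimal matroid\<close>

lemma component_rel_opt: "(a, b) \<in> component_rel opt \<longleftrightarrow> equivclp (basis_exchange opt) a b"
  by (simp add: component_rel_def opt_def)

lemma equiv_component_rel: "equiv UNIV (component_rel opt)"
  by (intro equivI refl_onI symI transI)
    (auto simp: component_rel_opt intro: equivclp_sym equivclp_trans)

text \<open>Both bases are optimal, so the exchange can be read in either direction and gives arrows
  both ways.\<close>

lemma basis_exchange_tight:
  assumes "basis_exchange opt a b" "S \<in> tight"
  shows "a \<in> S \<longleftrightarrow> b \<in> S"
proof -
  obtain B B' where B: "B \<in> bases opt" "B' \<in> bases opt" "B - B' = {a}" "B' - B = {b}"
    using assms(1) unfolding basis_exchange_def by blast
  have "insert b (B - {a}) = B'" "insert a (B' - {b}) = B" using B by blast+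
  then have "insert b (B - {a}) \<in> bases M" "insert a (B' - {b}) \<in> bases M"
    using B bases_opt by auto
  moreover have "a \<in> B" "a \<notin> B'" "b \<in> B'" "b \<notin> B" using B(3,4) by blast+
  ultimately show ?thesis using tightD[OF assms(2)] B(1,2) by metis
qed

lemma component_rel_tight:
  assumes "(a, b) \<in> component_rel opt" "S \<in> tight"
  shows "a \<in> S \<longleftrightarrow> b \<in> S"
  using assms(1) unfolding component_rel_opt
  by (induction rule: equivclp_induct) (use basis_exchange_tight assms(2) in blast)+

lemma component_rel_weight:
  assumes "(a, b) \<in> component_rel opt"
  shows "w a = w b"
  using component_rel_tight[OF assms superlevel_tight[of "w a"]]
    component_rel_tight[OF assms superlevel_tight[of "w b"]] by simp

text \<open>
  A tight set strictly between \<^term>\<open>X\<close> and \<^term>\<open>Z\<close> arises from a superlevel set of the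
  weight if \<^term>\<open>w\<close> is not constant on \<^term>\<open>Z - X\<close>, and from a component that
  \<^term>\<open>Z - X\<close> properly contains otherwise: swaps inside \<^term>\<open>Z - X\<close> then preserve the
  weight and so never leave a component.
\<close>

lemma tight_cover_component:
  assumes X: "X \<in> tight" and Z: "Z \<in> tight" and "X \<subseteq> Z"
    and cover: "\<And>Y. Y \<in> tight \<Longrightarrow> X \<subseteq> Y \<Longrightarrow> Y \<subseteq> Z \<Longrightarrow> Y = X \<or> Y = Z"
    and a: "a \<in> Z - X" and b: "b \<in> Z - X"
  shows "(a, b) \<in> component_rel opt"
proof -
  have wle: "w x \<le> w y" if x: "x \<in> Z - X" and y: "y \<in> Z - X" for x y
  proof -
    have "X \<union> (Z \<inter> {z. w x \<le> w z}) = X \<or> X \<union> (Z \<inter> {z. w x \<le> w z}) = Z"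
      using X Z \<open>X \<subseteq> Z\<close> by (intro cover Un_tight Int_tight superlevel_tight) auto
    then show ?thesis using x y by blast
  qed
  define C where "C = component_rel opt `` {a}"
  have aC: "a \<in> C" using equiv_class_self[OF equiv_component_rel] by (simp add: C_def)
  have CZ: "C \<subseteq> Z - X" using component_rel_tight X Z a unfolding C_def by blast
  have "X \<union> C \<in> tight"
    unfolding mem_tight_iff
  proof (intro ballI notI)
    fix B e f
    assume B: "B \<in> bases opt" and e: "e \<in> X \<union> C - B" and f: "f \<in> B - (X \<union> C)"
      and swap: "insert e (B - {f}) \<in> bases M"
    have eC: "e \<in> C" using tightD[OF X B swap] e f by blast
    moreover have "f \<in> Z" using tightD[OF Z B swap] e f CZ eC by blast
    ultimately have "w f \<le> w e" using wle[of f e] CZ f by blast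
    then have "insert e (B - {f}) \<in> bases opt" using swap_weight(2)[OF B _ _ swap] e f by blast
    moreover have "insert e (B - {f}) - B = {e}" "B - insert e (B - {f}) = {f}" using e f by auto
    ultimately have "basis_exchange opt e f" using B unfolding basis_exchange_def by blast
    then have "(e, f) \<in> component_rel opt" by (auto simp: component_rel_opt)
    then have "f \<in> C" using eC equiv_component_rel unfolding C_def by (auto elim: equivE dest: transD)
    then show False using f by blast
  qed
  then have "X \<union> C = Z" using cover[of "X \<union> C"] aC CZ \<open>X \<subseteq> Z\<close> a by blast
  then show ?thesis using b unfolding C_def by blast
qed

text \<open>Tight sets are unions of components, so the two sets differ by at most one component.
  Equality is allowed, which is harmless because flags may repeat a set.\<close>

definition step :: "'a set rel" where
  "step = {(X, Z). X \<in> tight \<and> Z \<in> tight \<and> X \<subseteq> Z \<and> (Z - X) \<times> (Z - X) \<subseteq> component_rel opt}"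

text \<open>A minimal tight set \<open>Z\<close> strictly above \<open>X\<close> inside
  \<open>Y\<close> covers \<open>X\<close>, so \<open>Z - X\<close> lies in one component; continue
  from \<open>Z\<close>.\<close>

lemma tight_chain:
  assumes "X \<in> tight" "Y \<in> tight" "X \<subseteq> Y"
  shows "(X, Y) \<in> step\<^sup>*"
  using assms(1,3)
proof (induction "card (Y - X)" arbitrary: X rule: less_induct)
  case less
  show ?case
  proof (cases "X = Y")
    case False
    let ?A = "{Z \<in> tight. X \<subset> Z \<and> Z \<subseteq> Y}"
    have "finite ?A" by simp
    moreover have "?A \<noteq> {}" using False less.prems assms(2) by blast
    ultimately have "\<exists>Z\<in>?A. \<forall>Z'\<in>?A. Z' \<subseteq> Z \<longrightarrow> Z = Z'" by (rule finite_has_minimal)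
    then obtain Z where Z: "Z \<in> ?A" and min: "\<forall>Z'\<in>?A. Z' \<subseteq> Z \<longrightarrow> Z = Z'" by (elim bexE)
    have cover: "W = X \<or> W = Z" if "W \<in> tight" "X \<subseteq> W" "W \<subseteq> Z" for W
    proof (cases "W = X")
      case False
      then have "W \<in> ?A" using Z that by auto
      then show ?thesis using min that(3) by blast
    qed simp
    have "(a, b) \<in> component_rel opt" if "a \<in> Z - X" "b \<in> Z - X" for a b
      using tight_cover_component[OF less.prems(1) _ _ cover that] Z by blast
    then have "(X, Z) \<in> step" unfolding step_def using less.prems Z by auto
    moreover have "card (Y - Z) < card (Y - X)"
      using Z less.prems by (intro psubset_card_mono) auto
    then have "(Z, Y) \<in> step\<^sup>*" using less.hyps Z by blast
    ultimately show ?thesis by (rule converse_rtrancl_into_rtrancl)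
  qed simp
qed

text \<open>A chain from the empty set to \<open>T\<close> is concatenated with a chain from
  \<open>T\<close> to the whole ground set.\<close>

lemma tight_flag:
  assumes "T \<in> tight"
  obtains k S where "is_flag M k S" "T \<in> S ` {0..Suc k}"
    "\<forall>i\<le>k. (S i, S (Suc i)) \<in> step"
proof -
  obtain m n where "({}, T) \<in> step ^^ m" "(T, UNIV) \<in> step ^^ n"
    using tight_chain[OF empty_tight assms] tight_chain[OF assms UNIV_tight] rtrancl_imp_relpow
    by blast
  then obtain f g where f: "f 0 = {}" "f m = T" "\<And>i. i < m \<Longrightarrow> (f i, f (Suc i)) \<in> step"
    and g: "g 0 = T" "g n = UNIV" "\<And>i. i < n \<Longrightarrow> (g i, g (Suc i)) \<in> step"
    unfolding relpow_fun_conv by blast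
  define S where "S i = (if i \<le> m then f i else g (i - m))" for i
  have st: "(S i, S (Suc i)) \<in> step" if "i < m + n" for i
  proof (cases "i < m")
    case False
    have "S i = g (i - m)" using False f g by (auto simp: S_def)
    moreover have "S (Suc i) = g (Suc (i - m))" using False by (simp add: S_def Suc_diff_le)
    ultimately show ?thesis using g(3)[of "i - m"] False that by simp
  qed (simp add: S_def f)
  have ends: "S 0 = {}" "S m = T" "S (m + n) = UNIV" using f g by (auto simp: S_def)
  \<comment> \<open>A flag with parameter \<open>k\<close> has \<open>Suc k\<close> steps, hence at
    least one; the chain does too, since the ground set is not empty.\<close>
  then have "m + n \<noteq> 0" by (metis empty_not_UNIV)
  then obtain k where k: "m + n = Suc k" by (metis not0_implies_Suc)
  have st': "(S i, S (Suc i)) \<in> step" if "i \<le> k" for i using st that k by simp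
  have "is_flag M k S"
    unfolding is_flag_def ground_UNIV using ends k st' by (auto simp: step_def)
  moreover have "T \<in> S ` {0..Suc k}" using ends k by (intro image_eqI[of _ _ m]) auto
  ultimately show ?thesis using that st' by blast
qed

section \<open>Flags whose successive differences lie in single components\<close>

context
  fixes k S
  assumes flag: "is_flag M k S" and steps: "\<And>i. i \<le> k \<Longrightarrow> (S i, S (Suc i)) \<in> step"
begin

lemma flag_tight: "i \<le> Suc k \<Longrightarrow> S i \<in> tight"
  using steps flag empty_tight by (cases i) (auto simp: step_def is_flag_def)

text \<open>The weight is constant on each difference of the flag, so the numbers
  \<open>card (B \<inter> S i)\<close> determine the weight of \<open>B\<close>. A basis of full
  rank on every member of the flag therefore weighs as much as an optimal one.\<close>

lemma bases_flag_matroid_opt: "bases (flag_matroid M k S) = bases opt"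
proof -
  have sum_eq: "sum w (A \<inter> S i) = sum w (B \<inter> S i)"
    if A: "\<And>j. j \<le> Suc k \<Longrightarrow> card (A \<inter> S j) = matroid_rank M (S j)"
      and B: "\<And>j. j \<le> Suc k \<Longrightarrow> card (B \<inter> S j) = matroid_rank M (S j)"
      and "i \<le> Suc k" for A B i
    using that(3)
  proof (induction i)
    case 0
    then show ?case using flag by (simp add: is_flag_def)
  next
    case (Suc i)
    have sub: "S i \<subseteq> S (Suc i)" using steps[of i] Suc.prems by (simp add: step_def)
    \<comment> \<open>The function \<open>h\<close> is kept general: it is \<open>w\<close> when
      comparing weights and the constant 1 when comparing cardinalities.\<close>
    have split: "sum h (D \<inter> S (Suc i)) = sum h (D \<inter> S i) + sum h (D \<inter> (S (Suc i) - S i))"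
      for D and h :: "'a \<Rightarrow> real"
    proof -
      have "D \<inter> S (Suc i) = (D \<inter> S i) \<union> (D \<inter> (S (Suc i) - S i))" using sub by blast
      moreover have "(D \<inter> S i) \<inter> (D \<inter> (S (Suc i) - S i)) = {}" by blast
      ultimately show ?thesis by (simp only: sum.union_disjoint finite)
    qed
    obtain d where d: "\<And>x. x \<in> S (Suc i) - S i \<Longrightarrow> w x = d"
    proof (cases "S (Suc i) - S i = {}")
      case True
      then show ?thesis using that by blast
    next
      case False
      then obtain y where y: "y \<in> S (Suc i) - S i" by blast
      have "(x, y) \<in> component_rel opt" if "x \<in> S (Suc i) - S i" for x
        using steps[of i] Suc.prems y that by (auto simp: step_def)
      then show ?thesis using that[of "w y"] component_rel_weight by blast
    qed
    have "sum w (D \<inter> (S (Suc i) - S i)) = d * real (card (D \<inter> (S (Suc i) - S i)))" for D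
    proof -
      have "sum w (D \<inter> (S (Suc i) - S i)) = (\<Sum>x\<in>D \<inter> (S (Suc i) - S i). d)"
        using d by (intro sum.cong) auto
      then show ?thesis by simp
    qed
    moreover have "card (A \<inter> (S (Suc i) - S i)) = card (B \<inter> (S (Suc i) - S i))"
      using split[of "\<lambda>_. 1" A] split[of "\<lambda>_. 1" B] A[of i] A[of "Suc i"] B[of i] B[of "Suc i"]
        Suc.prems by simp
    ultimately show ?case using Suc split[of w] by simp
  qed
  obtain B0 where B0: "B0 \<in> bases opt" using weight_attained bases_opt by blast
  have card_opt: "card (B \<inter> S i) = matroid_rank M (S i)" if "B \<in> bases opt" "i \<le> Suc k" for B i
    using flag_tight that unfolding tight_def by blast
  have "sum w B = c"
    if "\<forall>i\<le>Suc k. card (B \<inter> S i) = matroid_rank M (S i)" for B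
    using sum_eq[of B B0 "Suc k"] that card_opt[OF B0] flag B0
    by (simp add: is_flag_def ground_UNIV bases_opt)
  then show ?thesis
    unfolding bases_flag_matroid[OF flag] using card_opt bases_opt by auto
qed

text \<open>Optimal bases meet a difference of the flag in bases of the factor, so an exchange
  between optimal bases with both elements in the difference descends to the factor. Paths of
  exchanges cannot leave the difference, because its two bounding sets are tight.\<close>

lemma factor_connected_steps: "factor_connected M k S"
  unfolding factor_connected_def matroid_connected_def
proof (intro ballI)
  fix i a b assume i: "i \<in> {1..Suc k}"
  let ?K = "flag_factor M S i"
  assume a: "a \<in> ground ?K" and b: "b \<in> ground ?K"
  have G: "ground ?K = S i - S (i - 1)" by (rule ground_flag_factor)
  have exch: "basis_exchange ?K x y"
    if xy: "basis_exchange opt x y" "x \<in> S i - S (i - 1)" "y \<in> S i - S (i - 1)" for x y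
  proof -
    obtain B B' where B: "B \<in> bases opt" "B' \<in> bases opt" "B - B' = {x}" "B' - B = {y}"
      using xy(1) unfolding basis_exchange_def by blast
    then have "B \<in> bases (flag_matroid M k S)" "B' \<in> bases (flag_matroid M k S)"
      using bases_flag_matroid_opt by auto
    then have "B \<inter> (S i - S (i - 1)) \<in> bases ?K" "B' \<inter> (S i - S (i - 1)) \<in> bases ?K"
      using Int_flag_step_base_flag_factor[OF flag _ _ i] unfolding bases_flag_matroid[OF flag]
      by auto
    moreover have "B \<inter> (S i - S (i - 1)) - B' \<inter> (S i - S (i - 1)) = {x}"
      "B' \<inter> (S i - S (i - 1)) - B \<inter> (S i - S (i - 1)) = {y}"
      using B xy by blast+
    ultimately show ?thesis unfolding basis_exchange_def by blast
  qed
  have "(S (i - 1), S i) \<in> step" using steps[of "i - 1"] i by (cases i) auto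
  then have "(a, b) \<in> component_rel opt"
    using a b unfolding G step_def by blast
  then have "equivclp (basis_exchange opt) a b" by (simp add: component_rel_opt)
  \<comment> \<open>Membership in the difference is carried along the path, since only then does the
    next exchange descend to the factor.\<close>
  then have "b \<in> S i - S (i - 1) \<and> equivclp (basis_exchange ?K) a b"
  proof (induction rule: equivclp_induct)
    case base
    then show ?case using a G by simp
  next
    case (step y z)
    have "S i \<in> tight" "S (i - 1) \<in> tight" using flag_tight i by auto
    then have "z \<in> S i - S (i - 1)" using step basis_exchange_tight by blast
    moreover from this have "basis_exchange ?K y z \<or> basis_exchange ?K z y"
      using step exch by blast
    ultimately show ?case using step.IH equivclp_into_equivclp by metis
  qed
  then show "(a, b) \<in> component_rel ?K" using a b by (simp add: component_rel_def)
qed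

end

text \<open>A tight set lies on a flag with single-component steps. Conversely, every basis of a
  flag matroid has full rank on each member of the flag, and here these bases are the optimal
  ones.\<close>

lemma tight_iff_factor_connected_flag:
  "T \<in> tight \<longleftrightarrow> (\<exists>k S. is_flag M k S \<and> factor_connected M k S \<and>
     bases (flag_matroid M k S) = bases opt \<and> T \<in> S ` {0..Suc k})"
proof
  assume "T \<in> tight"
  then obtain k S where flag: "is_flag M k S" and T: "T \<in> S ` {0..Suc k}"
    and steps: "\<forall>i\<le>k. (S i, S (Suc i)) \<in> step"
    by (rule tight_flag)
  have "bases (flag_matroid M k S) = bases opt"
    by (rule bases_flag_matroid_opt[OF flag]) (use steps in blast)
  moreover have "factor_connected M k S"
    by (rule factor_connected_steps[OF flag]) (use steps in blast)
  ultimately show "\<exists>k S. is_flag M k S \<and> factor_connected M k S \<and>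
     bases (flag_matroid M k S) = bases opt \<and> T \<in> S ` {0..Suc k}"
    using flag T by blast
next
  assume "\<exists>k S. is_flag M k S \<and> factor_connected M k S \<and>
     bases (flag_matroid M k S) = bases opt \<and> T \<in> S ` {0..Suc k}"
  then obtain k S i where flag: "is_flag M k S" and b: "bases (flag_matroid M k S) = bases opt"
    and i: "i \<le> Suc k" "T = S i" by auto
  show "T \<in> tight"
    unfolding tight_def using b[symmetric] i bases_flag_matroid[OF flag] by auto
qed

section \<open>Components and tight sets\<close>

abbreviation comps :: "'a set set" where
  "comps \<equiv> matroid_components opt"

text \<open>The reflexive form of the order on components: the condition holds trivially for
  \<open>C = D\<close>, so the equality case of \<open>P_le\<close> is already included.\<close>

definition comp_le :: "'a set rel" where
  "comp_le = {(C, D). C \<in> comps \<and> D \<in> comps \<and> (\<forall>S\<in>tight. D \<subseteq> S \<longrightarrow> C \<subseteq> S)}"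

lemma comps_eq: "comps = UNIV // component_rel opt"
  by (simp add: matroid_components_def opt_def)

lemma comp_obtain:
  obtains C where "C \<in> comps" "x \<in> C"
proof -
  have "x \<in> \<Union>comps" unfolding comps_eq Union_quotient[OF equiv_component_rel] by simp
  then show ?thesis using that by (elim UnionE)
qed

lemma comp_eqI: "C \<in> comps \<Longrightarrow> D \<in> comps \<Longrightarrow> x \<in> C \<Longrightarrow> x \<in> D \<Longrightarrow> C = D"
  unfolding comps_eq using quotient_disj[OF equiv_component_rel] by blast

lemma comp_nonempty: "C \<in> comps \<Longrightarrow> C \<noteq> {}"
  unfolding comps_eq using in_quotient_imp_non_empty[OF equiv_component_rel] by blast

lemma comp_subset_tight:
  assumes "C \<in> comps" "S \<in> tight" "x \<in> C" "x \<in> S"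
  shows "C \<subseteq> S"
proof
  fix y assume "y \<in> C"
  then have "(x, y) \<in> component_rel opt"
    using assms(1,3) quotient_eq_iff[OF equiv_component_rel] unfolding comps_eq by metis
  then show "y \<in> S" using component_rel_tight assms(2,4) by blast
qed

text \<open>Let \<open>Z\<close> be the least tight set containing \<open>C\<close>, hence also the
  least containing \<open>D\<close>, and \<open>X\<close> a maximal tight set properly inside
  \<open>Z\<close>. Neither component lies in \<open>X\<close>, so both meet \<open>Z - X\<close>,
  which belongs to a single component because \<open>Z\<close> covers \<open>X\<close>.\<close>

lemma antisym_comp_le: "antisym comp_le"
proof (rule antisymI)
  fix C D assume "(C, D) \<in> comp_le" "(D, C) \<in> comp_le"
  then have C: "C \<in> comps" and D: "D \<in> comps" and same: "\<And>S. S \<in> tight \<Longrightarrow> C \<subseteq> S \<longleftrightarrow> D \<subseteq> S"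
    unfolding comp_le_def by blast+
  define Z where "Z = \<Inter>{S \<in> tight. C \<subseteq> S}"
  have Z: "Z \<in> tight" "C \<subseteq> Z" unfolding Z_def by (auto intro: Inter_tight)
  let ?A = "{X \<in> tight. X \<subset> Z}"
  have "finite ?A" by simp
  moreover have "?A \<noteq> {}" using empty_tight Z comp_nonempty[OF C] by blast
  ultimately have "\<exists>X\<in>?A. \<forall>X'\<in>?A. X \<subseteq> X' \<longrightarrow> X = X'" by (rule finite_has_maximal)
  then obtain X where X: "X \<in> ?A" and max: "\<forall>X'\<in>?A. X \<subseteq> X' \<longrightarrow> X = X'" by (elim bexE)
  have "\<not> C \<subseteq> X" using X unfolding Z_def by blast
  then have "\<not> D \<subseteq> X" using same X by blast
  obtain a b where a: "a \<in> C" "a \<notin> X" and b: "b \<in> D" "b \<notin> X"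
    using \<open>\<not> C \<subseteq> X\<close> \<open>\<not> D \<subseteq> X\<close> by blast
  have "a \<in> Z - X" "b \<in> Z - X" using a b Z same[OF Z(1)] by blast+
  moreover have "Y = X \<or> Y = Z" if "Y \<in> tight" "X \<subseteq> Y" "Y \<subseteq> Z" for Y
    using max that by blast
  ultimately have "(a, b) \<in> component_rel opt"
    using tight_cover_component[of X Z a b] X Z by blast
  then show "C = D"
    using quotient_eqI[OF equiv_component_rel] C D a b unfolding comps_eq by blast
qed

lemma partial_order_comp_le: "partial_order_on comps comp_le"
  unfolding partial_order_on_def preorder_on_def
  using antisym_comp_le by (auto simp: comp_le_def refl_on_def intro!: transI)

text \<open>For \<open>C\<close> in the ideal, every component meeting the least tight set
  \<open>Z C\<close> containing \<open>C\<close> is below \<open>C\<close>, hence in the ideal. So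
  the union of the ideal is the union of the tight sets \<open>Z C\<close>.\<close>

lemma Union_ideal_tight:
  assumes I: "I \<in> order_ideals comps comp_le"
  shows "\<Union>I \<in> tight"
proof -
  define Z where "Z C = \<Inter>{S \<in> tight. C \<subseteq> S}" for C
  have "Z C \<subseteq> \<Union>I" if C: "C \<in> I" for C
  proof
    fix x assume x: "x \<in> Z C"
    obtain D where D: "D \<in> comps" "x \<in> D" by (rule comp_obtain)
    have "D \<subseteq> S" if "S \<in> tight" "C \<subseteq> S" for S
      using comp_subset_tight[OF D(1) that(1) D(2)] x that unfolding Z_def by blast
    then have "(D, C) \<in> comp_le"
      using D C I unfolding comp_le_def order_ideals_def by blast
    then show "x \<in> \<Union>I" using I C D unfolding order_ideals_def by blast
  qed
  moreover have "C \<subseteq> Z C" for C unfolding Z_def by blast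
  ultimately have "\<Union>I = \<Union>(Z ` I)" by blast
  moreover have "Z C \<in> tight" for C unfolding Z_def by (rule Inter_tight) auto
  ultimately show ?thesis using Union_tight[of "Z ` I"] by auto
qed

text \<open>The components inside \<open>T\<close> cover \<open>T\<close>, and they form an ideal
  because \<open>T\<close> itself is among the test sets in the definition of the order.\<close>

lemma tight_eq_Union_ideal:
  assumes "T \<in> tight"
  shows "\<exists>I\<in>order_ideals comps comp_le. T = \<Union>I"
proof (rule bexI)
  show "{C \<in> comps. C \<subseteq> T} \<in> order_ideals comps comp_le"
    using assms unfolding order_ideals_def comp_le_def by blast
  show "T = \<Union>{C \<in> comps. C \<subseteq> T}"
  proof (intro subset_antisym subsetI)
    fix x assume "x \<in> T"
    moreover obtain C where "C \<in> comps" "x \<in> C" by (rule comp_obtain)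
    ultimately show "x \<in> \<Union>{C \<in> comps. C \<subseteq> T}" using comp_subset_tight assms by blast
  qed blast
qed

text \<open>Components are nonempty and disjoint, so any one point identifies the component
  containing it.\<close>

lemma Union_subset_Union_comps_iff:
  assumes "I \<subseteq> comps" "J \<subseteq> comps"
  shows "\<Union>I \<subseteq> \<Union>J \<longleftrightarrow> I \<subseteq> J"
proof
  assume sub: "\<Union>I \<subseteq> \<Union>J"
  show "I \<subseteq> J"
  proof
    fix C assume C: "C \<in> I"
    then obtain x where "x \<in> C" using assms comp_nonempty by blast
    moreover from this obtain D where "D \<in> J" "x \<in> D" using sub C by blast
    ultimately show "C \<in> J" using comp_eqI[of C D x] C assms by blast
  qed
qed blast

end

section \<open>Faces of the base polytope\<close>

lemma inner_basis_vec: "basis_vec S \<bullet> x = (\<Sum>e\<in>S. x $ e)"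
  by (simp add: basis_vec_def inner_sum_left inner_axis')

lemma inner_basis_vec_right: "x \<bullet> basis_vec S = (\<Sum>e\<in>S. x $ e)"
  using inner_basis_vec by (simp add: inner_commute)

lemma basis_vec_nth: "basis_vec B $ e = (if e \<in> B then 1 else 0)"
  by (simp add: basis_vec_def axis_def)

lemma sum_basis_vec: "(\<Sum>e\<in>S. basis_vec B $ e) = real (card (B \<inter> S))"
  by (simp add: basis_vec_nth sum.If_cases Int_commute)

lemma rank_hyperplane_eq: "rank_hyperplane M S = {x. basis_vec S \<bullet> x = real (matroid_rank M S)}"
  by (simp add: rank_hyperplane_def inner_basis_vec)

text \<open>A hyperplane is convex, so containment of the hull need only be tested on the vectors
  \<open>basis_vec B\<close>, where the sum over \<open>S\<close> counts
  \<open>B \<inter> S\<close>.\<close>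

lemma base_polytope_subset_rank_hyperplane_iff:
  "base_polytope N \<subseteq> rank_hyperplane M S \<longleftrightarrow> (\<forall>B\<in>bases N. card (B \<inter> S) = matroid_rank M S)"
proof -
  have "convex (rank_hyperplane M S)"
    unfolding rank_hyperplane_eq by (rule convex_hyperplane)
  then have "base_polytope N \<subseteq> rank_hyperplane M S \<longleftrightarrow> basis_vec ` bases N \<subseteq> rank_hyperplane M S"
    unfolding base_polytope_def by (metis hull_minimal hull_subset subset_trans)
  also have "\<dots> \<longleftrightarrow> (\<forall>B\<in>bases N. card (B \<inter> S) = matroid_rank M S)"
    by (auto simp: rank_hyperplane_def sum_basis_vec)
  finally show ?thesis .
qed

text \<open>The functional with coefficient 1 on \<open>B\<close> and -1 off \<open>B\<close> takes
  the value \<open>card B\<close> at \<open>basis_vec B\<close> and at most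
  \<open>card B - 1\<close> at every other 0/1 vector. If \<open>B\<close> were not a basis, it
  would separate \<open>basis_vec B\<close> from the polytope.\<close>

lemma basis_vec_in_base_polytope:
  assumes "basis_vec B \<in> base_polytope N"
  shows "B \<in> bases N"
proof (rule ccontr)
  assume B: "B \<notin> bases N"
  let ?a = "basis_vec B - basis_vec (- B)"
  have val: "?a \<bullet> basis_vec C = real (card (C \<inter> B)) - real (card (C - B))" for C
    by (simp add: inner_diff_left inner_basis_vec sum_basis_vec Diff_eq)
  have le: "?a \<bullet> basis_vec C \<le> real (card B) - 1" if "C \<noteq> B" for C
  proof (cases "C \<subseteq> B")
    case True
    then have "card C < card B" using that by (intro psubset_card_mono) auto
    moreover have "C \<inter> B = C" "C - B = {}" using True by auto
    ultimately show ?thesis unfolding val by simp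
  next
    case False
    then have "card (C - B) \<noteq> 0" by simp
    moreover have "card (C \<inter> B) \<le> card B" by (intro card_mono) auto
    ultimately show ?thesis unfolding val by linarith
  qed
  have "basis_vec ` bases N \<subseteq> {x. ?a \<bullet> x \<le> real (card B) - 1}"
  proof (rule image_subsetI)
    fix C assume "C \<in> bases N"
    then have "C \<noteq> B" using B by blast
    from le[OF this] show "basis_vec C \<in> {x. ?a \<bullet> x \<le> real (card B) - 1}"
      by (rule CollectI)
  qed
  then have "base_polytope N \<subseteq> {x. ?a \<bullet> x \<le> real (card B) - 1}"
    unfolding base_polytope_def by (intro hull_minimal convex_halfspace_le)
  then have "?a \<bullet> basis_vec B \<le> real (card B) - 1" using assms by blast
  then show False unfolding val by simp
qed

text \<open>The bases are recovered as the sets whose indicator vectors lie in the polytope. This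
  yields the uniqueness behind the definite description in \<open>face_matroid\<close>.\<close>

lemma base_polytope_eq_iff: "base_polytope N = base_polytope N' \<longleftrightarrow> bases N = bases N'"
proof
  assume eq: "base_polytope N = base_polytope N'"
  have sub: "basis_vec B \<in> base_polytope K" if "B \<in> bases K" for B and K :: "'a based_set"
    unfolding base_polytope_def using that by (auto intro: hull_inc)
  show "bases N = bases N'"
    using sub basis_vec_in_base_polytope eq by blast
qed (simp add: base_polytope_def)

lemma face_matroid_base_polytope:
  assumes "is_matroid N" "ground N = UNIV"
  shows "face_matroid (base_polytope N) = N"
  unfolding face_matroid_def
  by (rule the_equality) (use assms base_polytope_eq_iff based_set.expand in metis)+

text \<open>Every face of a polyhedron is exposed, so it is the equality case of a valid inequality
  \<open>a \<bullet> x \<le> c\<close>; the coordinates of \<open>a\<close> serve as weights. A face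
  of the hull of finitely many points is the hull of some of them, and those must have weight
  \<open>c\<close>.\<close>

lemma face_max_weight:
  fixes M :: "'n::finite based_set"
  assumes face: "\<sigma> face_of base_polytope M" and "\<sigma> \<noteq> {}"
  obtains w :: "'n \<Rightarrow> real" and c where "\<forall>B\<in>bases M. sum w B \<le> c" "\<exists>B\<in>bases M. sum w B = c"
    "\<sigma> = convex hull (basis_vec ` {B \<in> bases M. sum w B = c})"
proof -
  have "polyhedron (base_polytope M)"
    unfolding base_polytope_def by (intro polytope_imp_polyhedron polytope_convex_hull) simp
  then have "\<sigma> exposed_face_of base_polytope M" using face exposed_face_of_polyhedron by blast
  then obtain a c where le: "base_polytope M \<subseteq> {x. a \<bullet> x \<le> c}"
    and \<sigma>: "\<sigma> = base_polytope M \<inter> {x. a \<bullet> x = c}"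
    unfolding exposed_face_of_def by blast
  have vert: "basis_vec B \<in> base_polytope M" if "B \<in> bases M" for B
    unfolding base_polytope_def using that by (auto intro: hull_inc)
  obtain V where V: "V \<subseteq> basis_vec ` bases M" "\<sigma> = convex hull V"
  proof (rule face_of_convex_hull_subset)
    show "compact (basis_vec ` bases M)" by (simp add: finite_imp_compact)
    show "\<sigma> face_of convex hull (basis_vec ` bases M)"
      using face by (simp add: base_polytope_def)
  qed
  let ?w = "($) a"
  let ?O = "{B \<in> bases M. sum ?w B = c}"
  have "V \<subseteq> basis_vec ` ?O"
  proof
    fix v assume v: "v \<in> V"
    then have "v \<in> \<sigma>" using V(2) hull_inc by metis
    then have "a \<bullet> v = c" using \<sigma> by simp
    moreover obtain B where "B \<in> bases M" "v = basis_vec B" using v V(1) by blast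
    ultimately show "v \<in> basis_vec ` ?O" by (simp add: inner_basis_vec_right)
  qed
  then have "\<sigma> \<subseteq> convex hull (basis_vec ` ?O)" using V(2) hull_mono by metis
  moreover have "convex hull (basis_vec ` ?O) \<subseteq> \<sigma>"
  proof (rule hull_minimal)
    show "basis_vec ` ?O \<subseteq> \<sigma>" using \<sigma> vert by (auto simp: inner_basis_vec_right)
    show "convex \<sigma>" using face face_of_imp_convex by blast
  qed
  ultimately have eq: "\<sigma> = convex hull (basis_vec ` ?O)" by blast
  moreover have "\<exists>B\<in>bases M. sum ?w B = c" using eq \<open>\<sigma> \<noteq> {}\<close> by auto
  moreover have "sum ?w B \<le> c" if "B \<in> bases M" for B
    using le vert[OF that] by (auto simp: inner_basis_vec_right)
  ultimately show ?thesis using that by blast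
qed

text \<open>The last conjunct makes the bijection given by unions an order isomorphism, hence one of
  lattices. The empty set is a face in the sense of \<open>face_of\<close> but the base polytope of
  no matroid, whence the assumption that \<sigma> is nonempty.\<close>

theorem theorem2p9:
  fixes M :: "'n::finite based_set" and \<sigma> :: "(real ^ 'n) set"
  assumes "is_matroid M" and "ground M = UNIV"
    and "\<sigma> face_of base_polytope M" and "\<sigma> \<noteq> {}"
  shows "partial_order_on (P_elems \<sigma>) (P_le M \<sigma>)
    \<and> (\<forall>T. T \<in> L_face M \<sigma> \<longleftrightarrow> (\<exists>I\<in>order_ideals (P_elems \<sigma>) (P_le M \<sigma>). T = \<Union>I))
    \<and> bij_betw Union (order_ideals (P_elems \<sigma>) (P_le M \<sigma>)) (L_face M \<sigma>)
    \<and> (\<forall>I\<in>order_ideals (P_elems \<sigma>) (P_le M \<sigma>). \<forall>J\<in>order_ideals (P_elems \<sigma>) (P_le M \<sigma>).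
         I \<subseteq> J \<longleftrightarrow> \<Union>I \<subseteq> \<Union>J)"
proof -
  obtain w :: "'n \<Rightarrow> real" and c where w: "\<forall>B\<in>bases M. sum w B \<le> c" "\<exists>B\<in>bases M. sum w B = c"
    and hull: "\<sigma> = convex hull (basis_vec ` {B \<in> bases M. sum w B = c})"
    by (rule face_max_weight[OF assms(3,4)])
  interpret max_weight_bases M w c
    by unfold_locales (use assms w in auto)
  have \<sigma>: "\<sigma> = base_polytope opt" by (simp add: hull base_polytope_def opt_def)
  have "face_matroid \<sigma> = opt"
    unfolding \<sigma> by (rule face_matroid_base_polytope[OF opt_matroid]) (simp add: opt_def)
  then have P: "P_elems \<sigma> = comps" by (simp add: P_elems_def)
  have tight: "\<sigma> \<subseteq> rank_hyperplane M S \<longleftrightarrow> S \<in> tight" for S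
    by (simp add: \<sigma> base_polytope_subset_rank_hyperplane_iff tight_def)
  have le: "P_le M \<sigma> = comp_le"
    unfolding P_le_def P_less_def comp_le_def P tight by auto
  \<comment> \<open>Equality of polytopes is first turned into equality of sets of bases, which
    leaves the flag description of tight sets.\<close>
  have L: "L_face M \<sigma> = tight"
    unfolding L_face_def \<sigma> base_polytope_eq_iff
    by (intro set_eqI) (simp only: mem_Collect_eq tight_iff_factor_connected_flag
      eq_commute[of "bases opt"])
  let ?I = "order_ideals comps comp_le"
  have sub: "I \<subseteq> J \<longleftrightarrow> \<Union>I \<subseteq> \<Union>J" if "I \<in> ?I" "J \<in> ?I" for I J
    using that Union_subset_Union_comps_iff[of I J] by (simp add: order_ideals_def)
  have mem: "T \<in> tight \<longleftrightarrow> (\<exists>I\<in>?I. T = \<Union>I)" for T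
  proof
    show "\<exists>I\<in>?I. T = \<Union>I" if "T \<in> tight" using that by (rule tight_eq_Union_ideal)
    show "T \<in> tight" if "\<exists>I\<in>?I. T = \<Union>I" using that by (auto intro: Union_ideal_tight)
  qed
  have "inj_on Union ?I" by (rule inj_onI) (simp add: set_eq_subset sub)
  moreover have "Union ` ?I = tight" by (rule set_eqI) (simp only: mem image_iff)
  ultimately have "bij_betw Union ?I tight" by (simp add: bij_betw_def)
  then show ?thesis
    unfolding P le L by (intro conjI partial_order_comp_le allI ballI mem sub)
qed

end
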